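(* Let $S$ be an $le$-semigroup satisfying condition $\mathbf{\Lambda}$ (any two left ideal elements of $S$ commute with each other). Then every $\mathcal{J}$-class $J$ of $S$ satisfying the Green condition is a subsemigroup of $S$, i.e. $xy\in J$ for all $x,y\in J$.
   Context: An $le$-semigroup is a set $S$ with an associative multiplication and a partial order $\leq$ such that $a\leq b$ implies $xa\leq xb$ and $ax\leq bx$ for all $x\in S$, such that $(S,\leq)$ is a lattice with a greatest element $e$, and such that multiplication distributes over binary joins: $a(b\vee c)=ab\vee ac$ and $(a\vee b)c=ac\vee bc$ for all $a,b,c \in S$. An element $x\in S$ is a left ideal element if $ex\leq x$, a right ideal element if $xe\leq x$, and an ideal element if it is both. Condition $\mathbf{\Lambda}$: $xy=yx$ for any two left ideal elements $x,y$ of $S$. For $x\in S$ put $t(x)=exe\vee xe\vee ex\vee x$. The relation $\mathcal{J}$ is the equivalence relation $\{(x,y)\in S\times S : t(x)=t(y)\}$; its classes are the $\mathcal{J}$-classes. A $\mathcal{J}$-class $J$ satisfies the Green condition if there exist $b,c\in J$ with $bc\in J$. *)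

theory Defs
  imports Main
begin

unbundle lattice_syntax

class le_semigroup = semigroup_mult + bounded_lattice_top +
  assumes le_mult_left: "a \<le> b \<Longrightarrow> x * a \<le> x * b"
    and le_mult_right: "a \<le> b \<Longrightarrow> a * x \<le> b * x"
    and mult_sup_distrib_left: "a * (b \<squnion> c) = a * b \<squnion> a * c"
    and mult_sup_distrib_right: "(a \<squnion> b) * c = a * c \<squnion> b * c"

text \<open>The greatest element $e$ is \<open>\<top>\<close>.\<close>

definition left_ideal_element :: "'a::le_semigroup \<Rightarrow> bool" where
  "left_ideal_element x \<longleftrightarrow> \<top> * x \<le> x"

text \<open>A property of the whole structure, hence the type argument.\<close>

definition condition_Lambda :: "'a::le_semigroup itself \<Rightarrow> bool" where
  "condition_Lambda _ \<longleftrightarrow>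
    (\<forall>x y :: 'a. left_ideal_element x \<longrightarrow> left_ideal_element y \<longrightarrow> x * y = y * x)"

definition t_elem :: "'a::le_semigroup \<Rightarrow> 'a" where
  "t_elem x = \<top> * x * \<top> \<squnion> x * \<top> \<squnion> \<top> * x \<squnion> x"

definition J_rel :: "('a::le_semigroup \<times> 'a) set" where
  "J_rel = {(x, y). t_elem x = t_elem y}"

lemma equiv_J_rel: "equiv UNIV J_rel"
  by (auto simp: J_rel_def intro!: equivI refl_onI symI transI)

definition Green_condition :: "'a::le_semigroup set \<Rightarrow> bool" where
  "Green_condition J \<longleftrightarrow> (\<exists>b\<in>J. \<exists>c\<in>J. b * c \<in> J)"

end

theory Submission
  imports Defs
begin

text \<open>
  The greatest element is itself a left ideal element, so condition \<open>\<Lambda>\<close> makes it commute with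
  every left ideal element \<open>l\<close>, and in particular \<open>l * \<top> \<le> l\<close>: left ideal elements are
  two-sided. Therefore \<open>t_elem x\<close> collapses to \<open>\<top> * x \<squnion> x\<close>, the left ideal element generated
  by \<open>x\<close>, and this form yields the product rule \<open>t_elem (x * y) = t_elem x * y\<close>.

  Let \<open>t\<close> be the common value of \<open>t_elem\<close> on a class \<open>J\<close>, and let \<open>x\<close>, \<open>y\<close> lie in \<open>J\<close>. Since \<open>t\<close>
  is also a right ideal element, the right factor \<open>y\<close> may be replaced by the ideal element that
  it generates: \<open>t_elem (x * y) = t * y = t * t_elem y = t * t\<close>. So \<open>t_elem\<close> takes the same value
  \<open>t * t\<close> on all products of two elements of \<open>J\<close>. As soon as one of these products lies in \<open>J\<close>,
  this value is \<open>t\<close>, and then all of them lie in \<open>J\<close>.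
\<close>

lemma top_mult_top_mult_le: "\<top> * (\<top> * x) \<le> \<top> * (x::'a::le_semigroup)"
  by (metis le_mult_right mult.assoc top_greatest)

lemma left_ideal_element_generated:
  "left_ideal_element (\<top> * x \<squnion> (x::'a::le_semigroup))"
  unfolding left_ideal_element_def
  by (simp add: mult_sup_distrib_left top_mult_top_mult_le le_supI1)

text \<open>Taking one of the two commuting left ideal elements in \<open>\<Lambda>\<close> to be \<open>\<top>\<close>.\<close>

lemma left_ideal_element_mult_top:
  fixes l :: "'a::le_semigroup"
  assumes "condition_Lambda TYPE('a)" and "left_ideal_element l"
  shows "l * \<top> = \<top> * l"
  using assms unfolding condition_Lambda_def left_ideal_element_def by simp

text \<open>
  Commuting \<open>\<top>\<close> with \<open>\<top> * x \<squnion> x\<close> moves \<open>\<top>\<close> from the right of \<open>x\<close> to its left; this absorbs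
  the two terms of \<open>t_elem x\<close> that have a factor \<open>\<top>\<close> on the right.
\<close>

lemma t_elem_eq_left_generated:
  fixes x :: "'a::le_semigroup"
  assumes "condition_Lambda TYPE('a)"
  shows "t_elem x = \<top> * x \<squnion> x"
proof -
  have "(\<top> * x \<squnion> x) * \<top> = \<top> * (\<top> * x \<squnion> x)"
    using assms left_ideal_element_generated by (rule left_ideal_element_mult_top)
  also have "\<dots> \<le> \<top> * x"
    by (simp add: mult_sup_distrib_left top_mult_top_mult_le)
  finally have "\<top> * x * \<top> \<squnion> x * \<top> \<le> \<top> * x"
    by (simp add: mult_sup_distrib_right)
  then show ?thesis
    unfolding t_elem_def by (simp add: sup.absorb2)
qed

lemma t_elem_mult:
  fixes x y :: "'a::le_semigroup"
  assumes "condition_Lambda TYPE('a)"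
  shows "t_elem (x * y) = t_elem x * y"
  by (simp add: t_elem_eq_left_generated[OF assms] mult_sup_distrib_right mult.assoc)

text \<open>
  The extra term \<open>l * \<top> * y\<close> on the right-hand side is absorbed by \<open>l * y\<close>, because \<open>l\<close> is also
  a right ideal element.
\<close>

lemma left_ideal_element_mult_t_elem:
  fixes l y :: "'a::le_semigroup"
  assumes "condition_Lambda TYPE('a)" and "left_ideal_element l"
  shows "l * t_elem y = l * y"
proof -
  have "l * \<top> \<le> l"
    using left_ideal_element_mult_top[OF assms] assms(2)
    by (simp add: left_ideal_element_def)
  then have "l * (\<top> * y) \<le> l * y"
    by (metis le_mult_right mult.assoc)
  then show ?thesis
    by (simp add: t_elem_eq_left_generated[OF assms(1)] mult_sup_distrib_left sup.absorb2)
qed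

theorem theorem2p2:
  fixes J :: "'a::le_semigroup set"
  assumes "condition_Lambda TYPE('a)"
    and "J \<in> UNIV // J_rel"
    and "Green_condition J"
  shows "\<forall>x\<in>J. \<forall>y\<in>J. x * y \<in> J"
proof -
  obtain a where J: "J = {x. t_elem x = t_elem a}"
    using assms(2) by (force elim!: quotientE simp: J_rel_def)
  obtain b c where bc: "t_elem b = t_elem a" "t_elem c = t_elem a" "t_elem (b * c) = t_elem a"
    using assms(3) by (auto simp: Green_condition_def J)
  have product: "t_elem (x * y) = t_elem a * t_elem a"
    if "t_elem x = t_elem a" "t_elem y = t_elem a" for x y
    using left_ideal_element_mult_t_elem[OF assms(1), of "t_elem a" y] that
    by (simp add: t_elem_mult[OF assms(1)] t_elem_eq_left_generated[OF assms(1), of a]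
        left_ideal_element_generated)
  have "t_elem a * t_elem a = t_elem a"
    using product bc by metis
  then show ?thesis
    using product by (simp add: J)
qed

end
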